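(* Let $t,p,q,k$ be positive integers with $2t \leq p \leq t^2$, $q>0$ and $k \geq p+q$. Then $C_{p,q}$ is a submatrix of $A_{k,t}$.
   Context: For positive integers $k,t$ with $k\ge t$, $A_{k,t}$ is the $0,1$-matrix of size $\binom{k}{t}\times\binom{k}{t}$ whose rows and columns are indexed by all $t$-element subsets of $[k]=\{1,\dots,k\}$, with entry $1$ in row $x$, column $y$ if and only if $x\cap y\neq\emptyset$. For integers $p\ge 1$, $q\ge 0$ and $n=p+q$, $C_{p,q}$ is the $n\times n$ circulant $0,1$-matrix whose entry in row $i$, column $j$ ($1\le i,j\le n$) is $1$ iff $(i-j) \bmod n \in\{0,1,\dots,p-1\}$. An $n\times m$ $0,1$-matrix $M$ is a submatrix of $A_{k,t}$ if there are distinct $t$-subsets $F_1,\dots,F_n$ of $[k]$ and distinct $t$-subsets $G_1,\dots,G_m$ of $[k]$ with $M_{ij}=1$ iff $F_i\cap G_j\ne\emptyset$. *)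

theory Defs
  imports "Jordan_Normal_Form.Matrix"
begin

definition subsets_of_size :: "nat \<Rightarrow> nat \<Rightarrow> nat set set" where
  "subsets_of_size k t = {x. x \<subseteq> {1..k} \<and> card x = t}"

(* The matrix A_{k,t}. Its rows and columns are indexed directly by members of
   subsets_of_size k t, so no enumeration of the index set is chosen; k and t
   enter only through that index set. *)
definition intersection_entry :: "nat set \<Rightarrow> nat set \<Rightarrow> int" where
  "intersection_entry x y = (if x \<inter> y \<noteq> {} then 1 else 0)"

(* The matrix C_{p,q}. Indices run over 0..p+q-1 rather than 1..p+q; the entry
   depends only on i - j, so the shift does not matter. The difference is taken
   in int, where mod yields a value in {0..<p+q}. *)
definition circulant_matrix :: "nat \<Rightarrow> nat \<Rightarrow> int mat" where
  "circulant_matrix p q =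
     mat (p + q) (p + q)
       (\<lambda>(i, j). if (int i - int j) mod int (p + q) \<in> {0..int p - 1} then 1 else 0)"

(* M arises from the matrix B with row index set R and column index set S by
   choosing distinct rows and distinct columns, in any order. *)
definition is_submatrix_of :: "'a mat \<Rightarrow> 'r set \<Rightarrow> 'c set \<Rightarrow> ('r \<Rightarrow> 'c \<Rightarrow> 'a) \<Rightarrow> bool" where
  "is_submatrix_of M R S B \<longleftrightarrow>
     (\<exists>F G. F ` {..<dim_row M} \<subseteq> R \<and> inj_on F {..<dim_row M} \<and>
            G ` {..<dim_col M} \<subseteq> S \<and> inj_on G {..<dim_col M} \<and>
            (\<forall>i<dim_row M. \<forall>j<dim_col M. M $$ (i, j) = B (F i) (G j)))"

definition is_submatrix_of_A :: "int mat \<Rightarrow> nat \<Rightarrow> nat \<Rightarrow> bool" where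
  "is_submatrix_of_A M k t \<longleftrightarrow>
     is_submatrix_of M (subsets_of_size k t) (subsets_of_size k t) intersection_entry"

end

theory Submission imports Defs begin

text \<open>
  If \<open>A\<close> and \<open>B\<close> are \<open>t\<close>-sets of integers with sumset \<open>A + B = {0..<p}\<close>, then the
  translates \<open>F i = i - A\<close> and \<open>G j = j + B\<close> in the cyclic group of order \<open>n = p + q\<close> meet iff
  \<open>i - j\<close> is congruent to an element of \<open>A + B\<close>, which is the pattern of \<open>C\<^sub>p\<^sub>,\<^sub>q\<close>. One can take
  \<open>A = {0..<t}\<close> and any \<open>B\<close> from \<open>0\<close> to \<open>p - t\<close> without gaps larger than \<open>t\<close>. The translates
  are distinct because \<open>C\<^sub>p\<^sub>,\<^sub>q\<close> has neither repeated rows nor repeated columns.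
\<close>

text \<open>Induction on \<open>r\<close>: if \<open>s\<close> is not below \<open>b r + t\<close>,
  the gap bound gives \<open>b (Suc r) \<le> b r + t \<le> s\<close>, so the interval starting at
  \<open>b (Suc r)\<close> catches \<open>s\<close>.\<close>

lemma interval_cover_of_bounded_gaps:
  fixes b :: "nat \<Rightarrow> nat"
  assumes "b 0 = 0" and "\<And>i. b (Suc i) \<le> b i + t" and "s < b r + t"
  shows "\<exists>i\<le>r. b i \<le> s \<and> s < b i + t"
  using assms(3)
proof (induction r)
  case 0
  then show ?case using assms(1) by auto
next
  case (Suc r)
  show ?case
  proof (cases "s < b r + t")
    case True
    then show ?thesis using Suc.IH le_SucI by blast
  next
    case False
    then show ?thesis using Suc.prems assms(2)[of r] by (intro exI[of _ "Suc r"]) auto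
  qed
qed

lemma exists_interval_complement:
  fixes t p :: nat
  assumes "t > 0" and "2 * t \<le> p" and "p \<le> t\<^sup>2"
  obtains B :: "int set" where "card B = t"
    and "{a + b |a b. a \<in> {0..<int t} \<and> b \<in> B} = {0..<int p}"
proof -
  \<comment> \<open>Minimum of a line of slope \<open>t\<close> through 0 and a line of slope 1 that
    takes the value \<open>p - t\<close> at \<open>i = t - 1\<close>. Both rise by at least 1 and at
    most \<open>t\<close> per step, hence so does \<open>b\<close>. The subtraction is exact because
    \<open>2 * t \<le> p\<close>.\<close>
  define b where "b i = min (i * t) (p + 1 - 2 * t + i)" for i
  have mono: "strict_mono b"
    unfolding strict_mono_Suc_iff b_def using assms(1) by (auto simp: min_def)
  have gap: "b (Suc i) \<le> b i + t" for i
    unfolding b_def using assms(1) by (auto simp: min_def)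
  \<comment> \<open>Here \<open>p \<le> t\<^sup>2\<close> enters: it gives
    \<open>p - t \<le> (t - 1) * t\<close>, so at \<open>t - 1\<close> the minimum is the slope-1
    line.\<close>
  have "(t - 1) * t + t = t\<^sup>2"
    using assms(1) by (simp add: algebra_simps power2_eq_square)
  then have last: "b (t - 1) = p - t"
    unfolding b_def using assms by (auto simp: min_def)
  define B where "B = int ` b ` {..<t}"
  have "card B = t"
    unfolding B_def using mono strict_mono_on_imp_inj_on[OF mono]
    by (simp add: card_image inj_on_subset)
  moreover have "{a + c |a c. a \<in> {0..<int t} \<and> c \<in> B} = {0..<int p}"
  proof (intro equalityI subsetI)
    fix s assume "s \<in> {a + c |a c. a \<in> {0..<int t} \<and> c \<in> B}"
    then obtain a i where s: "s = a + int (b i)" "0 \<le> a" "a < int t" "i < t"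
      unfolding B_def by auto
    have "b i \<le> b (t - 1)"
      using mono s(4) by (simp add: strict_mono_less_eq)
    then show "s \<in> {0..<int p}"
      using s last assms by auto
  next
    fix s assume s: "s \<in> {0..<int p}"
    then have "nat s < b (t - 1) + t" using last assms by auto
    moreover have "b 0 = 0" by (simp add: b_def)
    ultimately obtain i where i: "i \<le> t - 1" "b i \<le> nat s" "nat s < b i + t"
      using interval_cover_of_bounded_gaps[of b t] gap by blast
    then have "s - int (b i) \<in> {0..<int t}" "int (b i) \<in> B"
      using s assms(1) by (auto simp: B_def)
    then show "s \<in> {a + c |a c. a \<in> {0..<int t} \<and> c \<in> B}"
      by (intro CollectI exI[of _ "s - int (b i)"] exI[of _ "int (b i)"]) simp
  qed
  ultimately show thesis by (rule that)
qed

text \<open>On a cycle of length \<open>n\<close>, a proper nonempty arc of \<open>p\<close> points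
  can be rotated to contain \<open>u\<close> but not \<open>v\<close>. This is what tells two
  translates apart.\<close>

lemma mod_separated:
  fixes p n u v :: int
  assumes "0 < p" and "p < n" and "u mod n \<noteq> v mod n"
  obtains z where "(u - z) mod n < p" and "\<not> (v - z) mod n < p"
proof -
  define d where "d = (v - u) mod n"
  have d: "0 < d" "d < n"
    using assms mod_eq_dvd_iff[of v n u] pos_mod_bound[of n "v - u"] pos_mod_sign[of n "v - u"]
    by (auto simp: d_def dvd_eq_mod_eq_0 less_le)
  \<comment> \<open>\<open>x\<close> is the offset of \<open>u\<close> in the arc starting at
    \<open>z = u - x\<close>; then \<open>v\<close> has offset \<open>d + x\<close>. The bound
    \<open>n - 1 - d\<close> prevents wrap-around, and \<open>d + x\<close> is at least
    \<open>p\<close> in either case: it is \<open>d + p - 1\<close> or \<open>n - 1\<close>.\<close>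
  define x where "x = min (p - 1) (n - 1 - d)"
  have "(u - (u - x)) mod n = x"
    using d assms by (auto simp: x_def mod_pos_pos_trivial)
  moreover have "(v - (u - x)) mod n = (d + x) mod n"
    unfolding d_def by (simp add: mod_simps algebra_simps)
  moreover have "(d + x) mod n = d + x"
    using d assms by (auto simp: x_def mod_pos_pos_trivial)
  moreover have "x < p" "\<not> d + x < p"
    using d assms by (auto simp: x_def)
  ultimately show thesis using that[of "u - x"] by simp
qed

text \<open>Names the residue classes modulo \<open>n\<close> by \<open>1..n\<close>; the successor
  matches the ground set \<open>{1..k}\<close>.\<close>

definition residue_label :: "nat \<Rightarrow> int \<Rightarrow> nat" where
  "residue_label n x = Suc (nat (x mod int n))"

lemma residue_label_eq_iff:
  assumes "n > 0"
  shows "residue_label n x = residue_label n y \<longleftrightarrow> x mod int n = y mod int n"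
  using assms by (simp add: residue_label_def eq_nat_nat_iff)

lemma residue_label_bounds:
  assumes "n > 0"
  shows "residue_label n x \<in> {1..n}"
proof -
  have "x mod int n < int n" using assms by simp
  then show ?thesis using assms by (simp add: residue_label_def Suc_le_eq nat_less_iff)
qed

text \<open>Used for rows with \<open>f x = i - x\<close> and for columns with
  \<open>f x = j + x\<close>.\<close>

lemma residue_label_image_in_subsets:
  assumes "n > 0" "n \<le> k" "card A = t"
    and "\<And>x y. \<lbrakk>x \<in> A; y \<in> A; f x mod int n = f y mod int n\<rbrakk> \<Longrightarrow> x = y"
  shows "(\<lambda>x. residue_label n (f x)) ` A \<in> subsets_of_size k t"
proof -
  have "inj_on (\<lambda>x. residue_label n (f x)) A"
    using assms by (auto intro!: inj_onI simp: residue_label_eq_iff)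
  moreover have "residue_label n (f x) \<in> {1..k}" for x
    using residue_label_bounds[of n "f x"] assms by auto
  ultimately show ?thesis
    using assms(3) by (auto simp: subsets_of_size_def card_image)
qed

lemma circulant_submatrix_of_sumset:
  fixes A B :: "int set"
  assumes "p > 0" "q > 0" "p + q \<le> k"
    and card: "card A = t" "card B = t"
    and sumset: "{a + b |a b. a \<in> A \<and> b \<in> B} = {0..<int p}"
  shows "is_submatrix_of_A (circulant_matrix p q) k t"
proof -
  define n where "n = p + q"
  have n: "n > 0" "n \<le> k" "p < n" using assms by (auto simp: n_def)
  define F where "F i = (\<lambda>a. residue_label n (i - a)) ` A" for i
  define G where "G j = (\<lambda>b. residue_label n (j + b)) ` B" for j
  have sum_bounds: "0 \<le> a + b \<and> a + b < int p" if "a \<in> A" "b \<in> B" for a b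
    using sumset that by (auto simp: set_eq_iff)
  \<comment> \<open>Fixed partners \<open>a0\<close> and \<open>b0\<close> turn the bounds on sums
    into bounds on differences: \<open>x + b0\<close> and \<open>y + b0\<close> both lie in
    \<open>{0..<int p}\<close>, so \<open>x\<close> and \<open>y\<close> in \<open>A\<close> differ
    by less than \<open>n\<close>; likewise in \<open>B\<close>.\<close>
  have "(0::int) \<in> {0..<int p}" using assms by simp
  then obtain a0 b0 where ab0: "a0 \<in> A" "b0 \<in> B" unfolding sumset[symmetric] by blast
  have meet: "F i \<inter> G j \<noteq> {} \<longleftrightarrow> (i - j) mod int n < int p" for i j
  proof -
    have "F i \<inter> G j \<noteq> {} \<longleftrightarrow> (\<exists>a\<in>A. \<exists>b\<in>B. residue_label n (i - a) = residue_label n (j + b))"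
      unfolding F_def G_def by auto
    also have "\<dots> \<longleftrightarrow> (\<exists>a\<in>A. \<exists>b\<in>B. (i - j) mod int n = (a + b) mod int n)"
      using n by (simp add: residue_label_eq_iff mod_eq_dvd_iff algebra_simps)
    also have "\<dots> \<longleftrightarrow> (\<exists>a\<in>A. \<exists>b\<in>B. (i - j) mod int n = a + b)"
    proof (intro bex_cong refl)
      fix a b assume "a \<in> A" "b \<in> B"
      then have "(a + b) mod int n = a + b"
        using sum_bounds[of a b] n by (intro mod_pos_pos_trivial) auto
      then show "((i - j) mod int n = (a + b) mod int n) = ((i - j) mod int n = a + b)" by simp
    qed
    also have "\<dots> \<longleftrightarrow> (i - j) mod int n \<in> {a + b |a b. a \<in> A \<and> b \<in> B}" by blast
    also have "\<dots> \<longleftrightarrow> (i - j) mod int n < int p"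
      unfolding sumset using n by simp
    finally show ?thesis .
  qed
  have eq_if: "x = y" if "x mod int n = y mod int n" "\<bar>x - y\<bar> < int n" for x y
  proof -
    have "int n dvd \<bar>x - y\<bar>" using that(1) by (simp add: mod_eq_dvd_iff)
    then show ?thesis using that(2) zdvd_imp_le[of "int n" "\<bar>x - y\<bar>"] by linarith
  qed
  have "F i \<in> subsets_of_size k t" for i
    unfolding F_def
  proof (rule residue_label_image_in_subsets[OF n(1,2) card(1)])
    fix x y assume xy: "x \<in> A" "y \<in> A" "(i - x) mod int n = (i - y) mod int n"
    then have "i - x = i - y"
      using sum_bounds[OF _ ab0(2), of x] sum_bounds[OF _ ab0(2), of y] n by (intro eq_if[OF xy(3)]) auto
    then show "x = y" by simp
  qed
  moreover have "G j \<in> subsets_of_size k t" for j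
    unfolding G_def
  proof (rule residue_label_image_in_subsets[OF n(1,2) card(2)])
    fix x y assume xy: "x \<in> B" "y \<in> B" "(j + x) mod int n = (j + y) mod int n"
    then have "j + x = j + y"
      using sum_bounds[OF ab0(1), of x] sum_bounds[OF ab0(1), of y] n by (intro eq_if[OF xy(3)]) auto
    then show "x = y" by simp
  qed
  \<comment> \<open>By \<open>meet\<close>, \<open>F i\<close> determines for which integers
    \<open>z\<close> the residue of \<open>i - z\<close> is below \<open>p\<close>, and
    \<open>mod_separated\<close> finds a \<open>z\<close> where two rows differ.\<close>
  moreover have "inj_on (\<lambda>i. F (int i)) {..<n}"
  proof (rule inj_onI, rule ccontr)
    fix i i' assume ii: "i \<in> {..<n}" "i' \<in> {..<n}" "F (int i) = F (int i')" "i \<noteq> i'"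
    then have "int i mod int n \<noteq> int i' mod int n" by simp
    then obtain z where "(int i - z) mod int n < int p" "\<not> (int i' - z) mod int n < int p"
      using mod_separated[of "int p" "int n"] n assms by auto
    then show False using meet ii(3) by metis
  qed
  \<comment> \<open>For columns the index enters \<open>meet\<close> negatively, so the separation
    is applied to \<open>- j\<close> and \<open>- j'\<close>, with \<open>F (- z)\<close> as the
    test row.\<close>
  moreover have "inj_on (\<lambda>j. G (int j)) {..<n}"
  proof (rule inj_onI, rule ccontr)
    fix j j' assume jj: "j \<in> {..<n}" "j' \<in> {..<n}" "G (int j) = G (int j')" "j \<noteq> j'"
    then have "\<bar>- int j - (- int j')\<bar> < int n" by auto
    then have "(- int j) mod int n \<noteq> (- int j') mod int n" using eq_if jj(4) by fastforce
    then obtain z where "(- int j - z) mod int n < int p" "\<not> (- int j' - z) mod int n < int p"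
      using mod_separated[of "int p" "int n"] n assms by auto
    then have "F (- z) \<inter> G (int j) \<noteq> {}" "\<not> F (- z) \<inter> G (int j') \<noteq> {}"
      unfolding meet minus_diff_commute[where b = z] by simp_all
    then show False using jj(3) by simp
  qed
  moreover have "circulant_matrix p q $$ (i, j) = intersection_entry (F (int i)) (G (int j))"
    if "i < n" "j < n" for i j
  proof -
    have "(int i - int j) mod int n \<in> {0..int p - 1} \<longleftrightarrow> F (int i) \<inter> G (int j) \<noteq> {}"
      unfolding meet using n by auto
    then show ?thesis
      using that unfolding circulant_matrix_def intersection_entry_def n_def by simp
  qed
  moreover have "dim_row (circulant_matrix p q) = n" "dim_col (circulant_matrix p q) = n"
    by (simp_all add: circulant_matrix_def n_def)
  ultimately show ?thesis
    unfolding is_submatrix_of_A_def is_submatrix_of_def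
    by (intro exI[of _ "\<lambda>i. F (int i)"] exI[of _ "\<lambda>j. G (int j)"]) auto
qed

theorem theorem3:
  fixes t p q k :: nat
  assumes "t > 0" and "p > 0" and "q > 0" and "k > 0"
    and "2 * t \<le> p" and "p \<le> t\<^sup>2"
    and "k \<ge> p + q"
  shows "is_submatrix_of_A (circulant_matrix p q) k t"
proof -
  obtain B :: "int set" where "card B = t"
    and "{a + b |a b. a \<in> {0..<int t} \<and> b \<in> B} = {0..<int p}"
    using exists_interval_complement assms by blast
  then show ?thesis
    using circulant_submatrix_of_sumset[of p q k "{0..<int t}" t B] assms by simp
qed

end
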